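(* Let $f\colon\Gamma\to G$ be a group homomorphism and let $p\colon\widetilde G\to G$ be a central $f$-extension, defined by a map $\widetilde f\colon\Gamma\to\widetilde G$ with $p\widetilde f=f$. Let $f'\colon[\Gamma,\Gamma]\to[G,G]$ and $\widetilde f'\colon[\Gamma,\Gamma]\to[\widetilde G,\widetilde G]$ be induced by $f$ and $\widetilde f$. Then there is a morphism of $f'$-extensions from $$1\longrightarrow\frac{H_2(G;\mathbb Z)}{f_*H_2(\Gamma;\mathbb Z)}\longrightarrow G\wedge_fG\longrightarrow[G,G]\longrightarrow1$$ to $$1\longrightarrow\ker p\cap[\widetilde G,\widetilde G]\longrightarrow[\widetilde G,\widetilde G]\xrightarrow{\ p\ }[G,G]\longrightarrow1 .$$ That is, both rows are exact and there is an epimorphism $\overline S\colon G\wedge_fG\to[\widetilde G,\widetilde G]$ whose composite with $p$ is the map $G\wedge_fG\to[G,G]$ of the first row, which satisfies $\overline S\rho_f=\widetilde f'$, and which restricts to an epimorphism $$\frac{H_2(G;\mathbb Z)}{f_*H_2(\Gamma;\mathbb Z)}\longrightarrow\ker p\cap[\widetilde G,\widetilde G].$$ Here $\rho_f\colon[\Gamma,\Gamma]\to G\wedge_fG$ and $\widetilde f'$ are the lifts of $f'$ to the two extensions. Consequently, if $H_2(G;\mathbb Z)/f_*H_2(\Gamma;\mathbb Z)$ and $[G,G]$ are finite, then $[\widetilde G,\widetilde G]$ is finite; moreover $$|[\widetilde G,\widetilde G]|\le\left|\frac{H_2(G;\mathbb Z)}{f_*H_2(\Gamma;\mathbb Z)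}\right|\,|[G,G]|.$$
   Context: For $f\colon\Gamma\to G$, an $f$-extension of $G$ is an epimorphism $p\colon\widetilde G\to G$ for which there is a homomorphism $\widetilde f\colon\Gamma\to\widetilde G$ with $p\widetilde f=f$; it is central if $\ker p\subseteq Z(\widetilde G)$. A morphism of $f$-extensions (with chosen lifts) is a homomorphism over $G$ compatible with the lifts. With ${}^{x}y=xyx^{-1}$ and $[x,y]=xyx^{-1}y^{-1}$, the non-abelian tensor square $G\otimes G$ is the group generated by symbols $g\otimes h$ ($g,h\in G$) with relations $gg'\otimes h=({}^{g}g'\otimes{}^{g}h)(g\otimes h)$, $g\otimes hh'=(g\otimes h)({}^{h}g\otimes{}^{h}h')$. The exterior square $G\wedge G$ is the quotient of $G\otimes G$ by the normal closure of all $g\otimes g$. There is a natural commutator homomorphism $G\wedge G\to G$, $g\wedge h\mapsto[g,h]$, with image $[G,G]$; its kernel is central in $G\wedge G$ and naturally identified with $H_2(G;\mathbb Z)$. Under this identification, $f_*H_2(\Gamma;\mathbb Z)$ is the image under $f\wedge f$ of $\ker(\Gamma\wedge\Gamma\to\Gamma)$. Put $G\wedge_fG=(G\wedge G)/f_*H_2(\Gamma;\mathbb Z)$; the commutator map induces $G\wedge_fG\to[G,G]$. Since $[\Gamma,\Gamma]\cong(\Gamma\wedge\Gamma)/H_2(\Gamma;\mathbb Z)$, the map $f\wedge f$ induces a homomorphism $\rho_f\colon[\Gamma,\Gamma]\to G\wedge_fG$, given by $\rho_f([x,y])=$ the class of $f(x)\wedge f(y)$. *)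

theory Defs
  imports "HOL-Algebra.Exact_Sequence" "HOL-Library.Equipollence"
begin

section \<open>Groups given by generators and relations\<close>

text \<open>
  A word over \<open>X\<close> is a list of letters \<open>(x, b)\<close>, which stands for \<open>x\<close> if \<open>b = True\<close> and for the
  formal inverse of \<open>x\<close> if \<open>b = False\<close>. A relation is a pair \<open>(u, v)\<close> of words, read \<open>u = v\<close>.
\<close>

type_synonym 'x word = "('x \<times> bool) list"

definition words :: "'x set \<Rightarrow> 'x word set" where
  "words X = lists (X \<times> UNIV)"

text \<open>The least congruence on words that makes the letters invertible and satisfies the relations.\<close>

inductive word_cong :: "'x set \<Rightarrow> ('x word \<times> 'x word) set \<Rightarrow> 'x word \<Rightarrow> 'x word \<Rightarrow> bool"
  for X :: "'x set" and R :: "('x word \<times> 'x word) set" where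
  refl: "w \<in> words X \<Longrightarrow> word_cong X R w w"
| sym: "word_cong X R u v \<Longrightarrow> word_cong X R v u"
| trans: "word_cong X R u v \<Longrightarrow> word_cong X R v w \<Longrightarrow> word_cong X R u w"
| append: "word_cong X R u v \<Longrightarrow> word_cong X R u' v' \<Longrightarrow> word_cong X R (u @ u') (v @ v')"
| cancel: "x \<in> X \<Longrightarrow> word_cong X R [(x, b), (x, \<not> b)] []"
| rel: "(u, v) \<in> R \<Longrightarrow> u \<in> words X \<Longrightarrow> v \<in> words X \<Longrightarrow> word_cong X R u v"

definition word_class :: "'x set \<Rightarrow> ('x word \<times> 'x word) set \<Rightarrow> 'x word \<Rightarrow> 'x word set" where
  "word_class X R u = {v. word_cong X R u v}"

definition presented_group :: "'x set \<Rightarrow> ('x word \<times> 'x word) set \<Rightarrow> 'x word set monoid" where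
  "presented_group X R =
     \<lparr>carrier = word_class X R ` words X,
      mult = (\<lambda>A B. \<Union>u\<in>A. \<Union>v\<in>B. word_class X R (u @ v)),
      one = word_class X R []\<rparr>"

primrec word_eval :: "('a, 'm) monoid_scheme \<Rightarrow> ('x \<Rightarrow> 'a) \<Rightarrow> 'x word \<Rightarrow> 'a" where
  "word_eval H \<phi> [] = \<one>\<^bsub>H\<^esub>"
| "word_eval H \<phi> (l # w) =
     (if snd l then \<phi> (fst l) else inv\<^bsub>H\<^esub> \<phi> (fst l)) \<otimes>\<^bsub>H\<^esub> word_eval H \<phi> w"

text \<open>
  The map from a presented group to \<open>H\<close> extending \<open>\<phi>\<close> on the generators; meaningful only if \<open>\<phi>\<close>
  respects the relations, since then \<open>word_eval H \<phi>\<close> is constant on each class.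
\<close>

definition presented_map :: "('a, 'm) monoid_scheme \<Rightarrow> ('x \<Rightarrow> 'a) \<Rightarrow> 'x word set \<Rightarrow> 'a" where
  "presented_map H \<phi> A = the_elem (word_eval H \<phi> ` A)"

text \<open>Likewise, the map induced on cosets by a map \<open>\<phi>\<close> that is constant on each of them.\<close>

definition coset_map :: "('a \<Rightarrow> 'b) \<Rightarrow> 'a set \<Rightarrow> 'b" where
  "coset_map \<phi> A = the_elem (\<phi> ` A)"

definition normal_closure :: "('a, 'm) monoid_scheme \<Rightarrow> 'a set \<Rightarrow> 'a set" where
  "normal_closure G S = \<Inter>{N. N \<lhd> G \<and> S \<subseteq> N}"

section \<open>Tensor and exterior squares\<close>

definition conjugate :: "('a, 'm) monoid_scheme \<Rightarrow> 'a \<Rightarrow> 'a \<Rightarrow> 'a" where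
  "conjugate G x y = x \<otimes>\<^bsub>G\<^esub> y \<otimes>\<^bsub>G\<^esub> inv\<^bsub>G\<^esub> x"

definition commutator :: "('a, 'm) monoid_scheme \<Rightarrow> 'a \<Rightarrow> 'a \<Rightarrow> 'a" where
  "commutator G x y = x \<otimes>\<^bsub>G\<^esub> y \<otimes>\<^bsub>G\<^esub> inv\<^bsub>G\<^esub> x \<otimes>\<^bsub>G\<^esub> inv\<^bsub>G\<^esub> y"

text \<open>The library's \<^const>\<open>derived\<close> uses the same convention for commutators.\<close>

definition commutator_group :: "('a, 'm) monoid_scheme \<Rightarrow> ('a, 'm) monoid_scheme" where
  "commutator_group G = G\<lparr>carrier := derived G (carrier G)\<rparr>"

definition center :: "('a, 'm) monoid_scheme \<Rightarrow> 'a set" where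
  "center G = {z \<in> carrier G. \<forall>g\<in>carrier G. z \<otimes>\<^bsub>G\<^esub> g = g \<otimes>\<^bsub>G\<^esub> z}"

definition tensor_relations ::
    "('a, 'm) monoid_scheme \<Rightarrow> (('a \<times> 'a) word \<times> ('a \<times> 'a) word) set" where
  "tensor_relations G =
     {([((g \<otimes>\<^bsub>G\<^esub> g', h), True)],
       [((conjugate G g g', conjugate G g h), True), ((g, h), True)]) | g g' h.
        g \<in> carrier G \<and> g' \<in> carrier G \<and> h \<in> carrier G} \<union>
     {([((g, h \<otimes>\<^bsub>G\<^esub> h'), True)],
       [((g, h), True), ((conjugate G h g, conjugate G h h'), True)]) | g h h'.
        g \<in> carrier G \<and> h \<in> carrier G \<and> h' \<in> carrier G}"

definition tensor_square :: "('a, 'm) monoid_scheme \<Rightarrow> ('a \<times> 'a) word set monoid" where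
  "tensor_square G = presented_group (carrier G \<times> carrier G) (tensor_relations G)"

definition tensor :: "('a, 'm) monoid_scheme \<Rightarrow> 'a \<Rightarrow> 'a \<Rightarrow> ('a \<times> 'a) word set" where
  "tensor G g h =
     word_class (carrier G \<times> carrier G) (tensor_relations G) [((g, h), True)]"

definition tensor_diagonal :: "('a, 'm) monoid_scheme \<Rightarrow> ('a \<times> 'a) word set set" where
  "tensor_diagonal G =
     normal_closure (tensor_square G) ((\<lambda>g. tensor G g g) ` carrier G)"

definition exterior_square :: "('a, 'm) monoid_scheme \<Rightarrow> ('a \<times> 'a) word set set monoid" where
  "exterior_square G = tensor_square G Mod tensor_diagonal G"

definition wedge :: "('a, 'm) monoid_scheme \<Rightarrow> 'a \<Rightarrow> 'a \<Rightarrow> ('a \<times> 'a) word set set" where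
  "wedge G g h = tensor_diagonal G #>\<^bsub>tensor_square G\<^esub> tensor G g h"

text \<open>The commutator map \<open>g \<and> h \<mapsto> [g, h]\<close>.\<close>

definition wedge_commutator :: "('a, 'm) monoid_scheme \<Rightarrow> ('a \<times> 'a) word set set \<Rightarrow> 'a" where
  "wedge_commutator G = coset_map (presented_map G (\<lambda>(g, h). commutator G g h))"

text \<open>The map \<open>f \<and> f\<close>, which sends \<open>x \<and> y\<close> to \<open>f x \<and> f y\<close>.\<close>

definition wedge_map ::
    "('a, 'm) monoid_scheme \<Rightarrow> ('c \<Rightarrow> 'a) \<Rightarrow> ('c \<times> 'c) word set set \<Rightarrow> ('a \<times> 'a) word set set" where
  "wedge_map G f =
     coset_map (presented_map (exterior_square G) (\<lambda>(x, y). wedge G (f x) (f y)))"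

text \<open>
  The integral second homology, under its natural identification with the kernel of the
  commutator map; functoriality is then given by \<^const>\<open>wedge_map\<close>.
\<close>

definition H2 :: "('a, 'm) monoid_scheme \<Rightarrow> ('a \<times> 'a) word set set set" where
  "H2 G = kernel (exterior_square G) G (wedge_commutator G)"

definition H2_image ::
    "('c, 'n) monoid_scheme \<Rightarrow> ('a, 'm) monoid_scheme \<Rightarrow> ('c \<Rightarrow> 'a) \<Rightarrow> ('a \<times> 'a) word set set set" where
  "H2_image \<Gamma> G f = wedge_map G f ` H2 \<Gamma>"

text \<open>
  The quotient of \<open>H2 G\<close> by \<open>f\<^sub>* H2 \<Gamma>\<close>. Its elements are cosets of \<^term>\<open>H2_image \<Gamma> G f\<close>, hence also
  elements of the group \<open>G \<and>\<^sub>f G\<close> below, and its inclusion into that group is the identity map.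
\<close>

definition H2_quotient ::
    "('c, 'n) monoid_scheme \<Rightarrow> ('a, 'm) monoid_scheme \<Rightarrow> ('c \<Rightarrow> 'a) \<Rightarrow>
     ('a \<times> 'a) word set set set monoid" where
  "H2_quotient \<Gamma> G f = (exterior_square G)\<lparr>carrier := H2 G\<rparr> Mod H2_image \<Gamma> G f"

definition relative_exterior_square ::
    "('c, 'n) monoid_scheme \<Rightarrow> ('a, 'm) monoid_scheme \<Rightarrow> ('c \<Rightarrow> 'a) \<Rightarrow>
     ('a \<times> 'a) word set set set monoid" where
  "relative_exterior_square \<Gamma> G f = exterior_square G Mod H2_image \<Gamma> G f"

definition relative_commutator ::
    "('a, 'm) monoid_scheme \<Rightarrow> ('a \<times> 'a) word set set set \<Rightarrow> 'a" where
  "relative_commutator G = coset_map (wedge_commutator G)"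

text \<open>
  The map \<open>\<rho>\<^sub>f\<close>: the class of \<open>(f \<and> f) w\<close> for any \<open>w\<close> in the exterior square of \<open>\<Gamma>\<close>
  that the commutator map sends to the given element of \<open>[\<Gamma>, \<Gamma>]\<close>. This does not depend on \<open>w\<close>,
  since the kernel \<open>H2 \<Gamma>\<close> is mapped into \<open>f\<^sub>* H2 \<Gamma>\<close>; in particular \<open>\<rho>\<^sub>f [x, y]\<close> is the class of \<open>f x \<and> f y\<close>.
\<close>

definition rho ::
    "('c, 'n) monoid_scheme \<Rightarrow> ('a, 'm) monoid_scheme \<Rightarrow> ('c \<Rightarrow> 'a) \<Rightarrow> 'c \<Rightarrow>
     ('a \<times> 'a) word set set set" where
  "rho \<Gamma> G f c =
     the_elem ((\<lambda>w. H2_image \<Gamma> G f #>\<^bsub>exterior_square G\<^esub> wedge_map G f w) `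
       {w \<in> carrier (exterior_square \<Gamma>). wedge_commutator \<Gamma> w = c})"

section \<open>Extensions relative to a homomorphism\<close>

text \<open>\<open>p\<close> is an \<open>f\<close>-extension of \<open>G\<close>, with chosen lift \<open>ft\<close> of \<open>f\<close>.\<close>

definition f_extension ::
    "('c, 'n) monoid_scheme \<Rightarrow> ('a, 'm) monoid_scheme \<Rightarrow> ('c \<Rightarrow> 'a) \<Rightarrow>
     ('b, 'k) monoid_scheme \<Rightarrow> ('b \<Rightarrow> 'a) \<Rightarrow> ('c \<Rightarrow> 'b) \<Rightarrow> bool" where
  "f_extension \<Gamma> G f Gt p ft \<longleftrightarrow>
     group \<Gamma> \<and> group G \<and> group Gt \<and> f \<in> hom \<Gamma> G \<and> p \<in> epi Gt G \<and> ft \<in> hom \<Gamma> Gt \<and>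
     (\<forall>x\<in>carrier \<Gamma>. p (ft x) = f x)"

definition central_f_extension ::
    "('c, 'n) monoid_scheme \<Rightarrow> ('a, 'm) monoid_scheme \<Rightarrow> ('c \<Rightarrow> 'a) \<Rightarrow>
     ('b, 'k) monoid_scheme \<Rightarrow> ('b \<Rightarrow> 'a) \<Rightarrow> ('c \<Rightarrow> 'b) \<Rightarrow> bool" where
  "central_f_extension \<Gamma> G f Gt p ft \<longleftrightarrow>
     f_extension \<Gamma> G f Gt p ft \<and> kernel Gt G p \<subseteq> center Gt"

definition f_extension_morphism ::
    "('c, 'n) monoid_scheme \<Rightarrow> ('b, 'k) monoid_scheme \<Rightarrow> ('b \<Rightarrow> 'a) \<Rightarrow> ('c \<Rightarrow> 'b) \<Rightarrow>
     ('d, 'l) monoid_scheme \<Rightarrow> ('d \<Rightarrow> 'a) \<Rightarrow> ('c \<Rightarrow> 'd) \<Rightarrow> ('b \<Rightarrow> 'd) \<Rightarrow> bool" where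
  "f_extension_morphism \<Gamma> G1 p1 f1 G2 p2 f2 \<phi> \<longleftrightarrow>
     \<phi> \<in> hom G1 G2 \<and> (\<forall>x\<in>carrier G1. p2 (\<phi> x) = p1 x) \<and> (\<forall>c\<in>carrier \<Gamma>. \<phi> (f1 c) = f2 c)"

definition commutator_kernel ::
    "('b, 'k) monoid_scheme \<Rightarrow> ('a, 'm) monoid_scheme \<Rightarrow> ('b \<Rightarrow> 'a) \<Rightarrow> ('b, 'k) monoid_scheme" where
  "commutator_kernel Gt G p = Gt\<lparr>carrier := kernel Gt G p \<inter> derived Gt (carrier Gt)\<rparr>"

text \<open>
  The library's \<^const>\<open>short_exact_sequence\<close> requires all the groups to have the same element type.
\<close>

definition short_exact ::
    "('a, 'm) monoid_scheme \<Rightarrow> ('a \<Rightarrow> 'b) \<Rightarrow> ('b, 'n) monoid_scheme \<Rightarrow> ('b \<Rightarrow> 'c) \<Rightarrow>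
     ('c, 'k) monoid_scheme \<Rightarrow> bool" where
  "short_exact A i B q C \<longleftrightarrow>
     group A \<and> group B \<and> group C \<and> i \<in> mon A B \<and> q \<in> epi B C \<and> i ` carrier A = kernel B C q"

end

theory Submission
  imports Defs
begin

text \<open>
  Write \<open>E = Gt\<close> for the central extension. A commutator \<open>[x, y]\<close> in \<open>E\<close> does not change when \<open>x\<close> or \<open>y\<close>
  is multiplied by a central element, so it depends only on \<open>p x\<close> and \<open>p y\<close>. Hence \<open>(g, h) \<mapsto> [x, y]\<close>,
  for any lifts \<open>x\<close> of \<open>g\<close> and \<open>y\<close> of \<open>h\<close>, is a well defined function on pairs of elements of \<open>G\<close>, and it
  inherits from the commutators of \<open>E\<close> the laws of an exterior pairing. By the universal property of
  the exterior square it extends to a homomorphism \<open>G \<and> G \<rightarrow> E\<close>. Its image is \<open>[E, E]\<close>, since it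
  takes all commutators of \<open>E\<close> as values, and its composite with \<open>p\<close> is the commutator map of \<open>G\<close>.

  The lift \<open>ft\<close> of \<open>f\<close> provides lifts of \<open>f x\<close> and \<open>f y\<close>, so the composite of this homomorphism with \<open>f \<and> f\<close>
  is \<open>ft\<close> applied to the commutator map of \<open>\<Gamma>\<close>. It therefore vanishes on \<open>f\<^sub>* H\<^sub>2(\<Gamma>)\<close> and induces the
  epimorphism \<open>S\<close> from \<open>G \<and>\<^sub>f G\<close> to \<open>[E, E]\<close>; the same formula gives the compatibility of \<open>S\<close> with \<open>\<rho>\<^sub>f\<close>.
  As \<open>p \<circ> S\<close> is the commutator map, an element of \<open>G \<and>\<^sub>f G\<close> lies in the kernel of that map exactly when
  its image lies in the kernel of \<open>p\<close>, so \<open>S\<close> is also onto between the kernels. The bound on the size of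
  \<open>[E, E]\<close> follows because \<open>[E, E]\<close> is an image of \<open>G \<and>\<^sub>f G\<close>, whose size is that of the kernel times that
  of \<open>[G, G]\<close>.

  What is left is to know that \<open>G \<and>\<^sub>f G\<close> is a group, that is, that \<open>f\<^sub>* H\<^sub>2(\<Gamma>)\<close> is normal in \<open>G \<and> G\<close>. This
  follows from the centrality of \<open>H\<^sub>2(G)\<close> (\<open>H2_central\<close>), which rests on the identity
  \<open>z (a \<and> b) z\<^sup>-\<^sup>1 = \<^sup>ca \<and> \<^sup>cb\<close>, where \<open>c\<close> is the commutator of \<open>z\<close>. For \<open>z = g \<and> h\<close> it is obtained
  from the two expansions of \<open>g a \<and> h b\<close> (lemmas \<open>braid\<close> and \<open>conjugate_pairing\<close>).
\<close>

section \<open>Group-theoretic preliminaries\<close>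

lemma group_homI: "group A \<Longrightarrow> group B \<Longrightarrow> h \<in> hom A B \<Longrightarrow> group_hom A B h"
  by (simp add: group_hom_def group_hom_axioms_def)

lemma (in group) mult_inv_cancel_left:
  "x \<in> carrier G \<Longrightarrow> y \<in> carrier G \<Longrightarrow> x \<otimes> (inv x \<otimes> y) = y"
  by (simp flip: m_assoc)

lemma (in group) inv_mult_cancel_left:
  "x \<in> carrier G \<Longrightarrow> y \<in> carrier G \<Longrightarrow> inv x \<otimes> (x \<otimes> y) = y"
  by (simp flip: m_assoc)

lemmas (in group) group_normalize =
  m_assoc inv_mult_group mult_inv_cancel_left inv_mult_cancel_left

lemma (in group) conjugate_closed [simp]:
  "x \<in> carrier G \<Longrightarrow> y \<in> carrier G \<Longrightarrow> conjugate G x y \<in> carrier G"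
  by (simp add: conjugate_def)

lemma (in group) commutator_closed [simp]:
  "x \<in> carrier G \<Longrightarrow> y \<in> carrier G \<Longrightarrow> commutator G x y \<in> carrier G"
  by (simp add: commutator_def)

lemma (in group) conjugate_mult:
  "x \<in> carrier G \<Longrightarrow> y \<in> carrier G \<Longrightarrow> z \<in> carrier G \<Longrightarrow>
    conjugate G x (y \<otimes> z) = conjugate G x y \<otimes> conjugate G x z"
  by (simp add: conjugate_def group_normalize)

lemma (in group) conjugate_conjugate:
  "x \<in> carrier G \<Longrightarrow> y \<in> carrier G \<Longrightarrow> z \<in> carrier G \<Longrightarrow>
    conjugate G x (conjugate G y z) = conjugate G (x \<otimes> y) z"
  by (simp add: conjugate_def group_normalize)

lemma (in group) conjugate_conjugate_conjugate:
  "x \<in> carrier G \<Longrightarrow> y \<in> carrier G \<Longrightarrow> z \<in> carrier G \<Longrightarrow>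
    conjugate G (conjugate G x y) (conjugate G x z) = conjugate G (x \<otimes> y) z"
  by (simp add: conjugate_def group_normalize)

lemma (in group) conjugate_one: "y \<in> carrier G \<Longrightarrow> conjugate G \<one> y = y"
  by (simp add: conjugate_def)

lemma (in group_hom) hom_conjugate:
  "x \<in> carrier G \<Longrightarrow> y \<in> carrier G \<Longrightarrow> h (conjugate G x y) = conjugate H (h x) (h y)"
  by (simp add: conjugate_def)

lemma (in group_hom) hom_commutator:
  "x \<in> carrier G \<Longrightarrow> y \<in> carrier G \<Longrightarrow> h (commutator G x y) = commutator H (h x) (h y)"
  by (simp add: commutator_def)

text \<open>
  The groups below are given by generators, so equality of two maps out of them is always
  reduced to the generators through this lemma.
\<close>

lemma (in group_hom) hom_eq_on_generate:
  assumes "group_hom G H k" and "S \<subseteq> carrier G" and "\<And>s. s \<in> S \<Longrightarrow> h s = k s"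
    and "x \<in> generate G S"
  shows "h x = k x"
proof -
  interpret K: group_hom G H k by fact
  from assms(4) show ?thesis
  proof (induction x rule: generate.induct)
    case (eng x y)
    then show ?case using G.generate_in_carrier[OF assms(2)] by simp
  qed (use assms(2,3) in auto)
qed

lemma derived_eq_generate:
  "derived G (carrier G) = generate G ((\<lambda>(x, y). commutator G x y) ` (carrier G \<times> carrier G))"
  unfolding derived_def by (rule arg_cong[where f = "generate G"]) (auto simp: commutator_def)

lemma (in group) group_commutator_group: "group (commutator_group G)"
  unfolding commutator_group_def
  by (rule subgroup_imp_group) (simp add: derived_is_subgroup)

lemma (in group) derived_subset: "derived G (carrier G) \<subseteq> carrier G"
  by (rule derived_in_carrier) simp

lemma (in group_hom) derived_image_commutators:
  "h ` derived G (carrier G) =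
     generate H ((\<lambda>(x, y). commutator H (h x) (h y)) ` (carrier G \<times> carrier G))"
proof -
  have "h ` (\<lambda>(x, y). commutator G x y) ` (carrier G \<times> carrier G) =
      (\<lambda>(x, y). commutator H (h x) (h y)) ` (carrier G \<times> carrier G)"
    unfolding image_image by (intro image_cong) (auto simp: hom_commutator)
  moreover have "(\<lambda>(x, y). commutator G x y) ` (carrier G \<times> carrier G) \<subseteq> carrier G" by auto
  ultimately show ?thesis by (metis derived_eq_generate generate_img)
qed

lemma (in group_hom) hom_derived: "h \<in> hom (commutator_group G) (commutator_group H)"
proof -
  have "h ` derived G (carrier G) \<subseteq> derived H (carrier H)"
    unfolding derived_image_commutators derived_eq_generate[of H]
    by (rule H.mono_generate) force
  then show ?thesis
    using G.derived_subset by (auto simp: hom_def commutator_group_def subset_iff)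
qed

lemma (in group) normal_closure_normal:
  assumes "S \<subseteq> carrier G" shows "normal_closure G S \<lhd> G"
proof -
  have all: "\<And>N. N \<lhd> G \<Longrightarrow> subgroup N G" by (simp add: normal_def)
  have ex: "carrier G \<in> {N. N \<lhd> G \<and> S \<subseteq> N}" using assms normal_self by simp
  have "subgroup (normal_closure G S) G"
    unfolding normal_closure_def by (rule subgroups_Inter) (use all ex in auto)
  then show ?thesis
    by (auto simp: normal_inv_iff normal_closure_def)
qed

lemma normal_closure_incl: "S \<subseteq> normal_closure G S"
  by (auto simp: normal_closure_def)

lemma normal_closure_minimal: "N \<lhd> G \<Longrightarrow> S \<subseteq> N \<Longrightarrow> normal_closure G S \<subseteq> N"
  by (auto simp: normal_closure_def)

text \<open>
  The image of a coset under a homomorphism that kills \<open>N\<close> is a singleton, so that the description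
  operator hidden in \<^const>\<open>coset_map\<close> picks the expected value. Together with the next lemma this is
  the universal property of the quotient.
\<close>

lemma coset_map_rcoset:
  assumes "N \<lhd> A" and "group_hom A B h" and "N \<subseteq> kernel A B h" and "x \<in> carrier A"
  shows "coset_map h (N #>\<^bsub>A\<^esub> x) = h x"
proof -
  interpret N: normal N A by fact
  interpret h: group_hom A B h by fact
  have "h ` (N #>\<^bsub>A\<^esub> x) = (\<lambda>n. h (n \<otimes>\<^bsub>A\<^esub> x)) ` N"
    by (auto simp: r_coset_def)
  also have "(\<lambda>n. h (n \<otimes>\<^bsub>A\<^esub> x)) ` N = (\<lambda>n. h x) ` N"
    using assms(3,4) by (intro image_cong) (auto simp: kernel_def)
  also have "(\<lambda>n. h x) ` N = {h x}"
    by (rule image_constant[OF subgroup.one_closed[OF N.subgroup_axioms]])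
  finally have "h ` (N #>\<^bsub>A\<^esub> x) = {h x}" .
  then show ?thesis by (simp add: coset_map_def)
qed

lemma coset_map_hom:
  assumes "N \<lhd> A" and "group_hom A B h" and "N \<subseteq> kernel A B h"
  shows "group_hom (A Mod N) B (coset_map h)"
proof -
  interpret N: normal N A by fact
  interpret h: group_hom A B h by fact
  note eq = coset_map_rcoset[OF assms]
  have "coset_map h \<in> hom (A Mod N) B"
    by (auto simp: hom_def carrier_FactGroup N.rcos_sum eq)
  then show ?thesis using N.factorgroup_is_group by (simp add: group_homI)
qed

lemma normal_quotient_hom:
  assumes "N \<lhd> A" shows "group_hom A (A Mod N) (\<lambda>x. N #>\<^bsub>A\<^esub> x)"
proof -
  interpret N: normal N A by fact
  show ?thesis
    by (intro group_homI N.is_group N.factorgroup_is_group N.r_coset_hom_Mod)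
qed

lemma (in group) rcoset_eq_self_iff:
  "subgroup N G \<Longrightarrow> x \<in> carrier G \<Longrightarrow> N #> x = N \<longleftrightarrow> x \<in> N"
  using coset_join1 coset_join2 subgroup.subset by blast

lemma (in group) central_subgroup_normal:
  assumes "subgroup N G" and "N \<subseteq> center G" shows "N \<lhd> G"
  unfolding normal_inv_iff
proof (intro conjI ballI)
  fix x n assume x: "x \<in> carrier G" and n: "n \<in> N"
  then have "n \<in> carrier G" "x \<otimes> n = n \<otimes> x" using assms(2) by (auto simp: center_def)
  then show "x \<otimes> n \<otimes> inv x \<in> N" using x n by (simp add: m_assoc)
qed fact

section \<open>Presented groups\<close>

lemma words_append [simp]: "u @ v \<in> words X \<longleftrightarrow> u \<in> words X \<and> v \<in> words X"
  by (simp add: words_def)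

lemma words_Nil [simp]: "[] \<in> words X"
  by (simp add: words_def)

lemma words_Cons [simp]: "l # w \<in> words X \<longleftrightarrow> fst l \<in> X \<and> w \<in> words X"
  by (cases l) (auto simp: words_def)

lemma word_cong_words: "word_cong X R u v \<Longrightarrow> u \<in> words X \<and> v \<in> words X"
  by (induction rule: word_cong.induct) auto

lemma word_class_eq_iff:
  "u \<in> words X \<Longrightarrow> word_class X R u = word_class X R v \<longleftrightarrow> word_cong X R u v"
  unfolding word_class_def
  by (auto intro: word_cong.refl word_cong.sym word_cong.trans)

lemma presented_group_mult:
  assumes "u \<in> words X" and "v \<in> words X"
  shows "word_class X R u \<otimes>\<^bsub>presented_group X R\<^esub> word_class X R v = word_class X R (u @ v)"
proof -
  have "word_class X R (u' @ v') = word_class X R (u @ v)"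
    if "word_cong X R u u'" "word_cong X R v v'" for u' v'
    using that word_cong_words[OF word_cong.append[OF that]]
    by (metis word_class_eq_iff word_cong.append)
  moreover have "word_cong X R u u" "word_cong X R v v"
    using assms by (auto intro: word_cong.refl)
  ultimately have "(\<Union>u'\<in>word_class X R u. \<Union>v'\<in>word_class X R v. word_class X R (u' @ v')) =
      word_class X R (u @ v)"
    unfolding word_class_def[of X R u] word_class_def[of X R v] by blast
  then show ?thesis by (simp add: presented_group_def)
qed

lemma carrier_presented_group: "carrier (presented_group X R) = word_class X R ` words X"
  by (simp add: presented_group_def)

lemma one_presented_group: "\<one>\<^bsub>presented_group X R\<^esub> = word_class X R []"
  by (simp add: presented_group_def)

lemma word_cong_inverse_letter: "x \<in> X \<Longrightarrow> word_cong X R [(x, \<not> b), (x, b)] []"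
  using word_cong.cancel[of x X R "\<not> b"] by simp

lemma word_cong_left_inverse:
  "u \<in> words X \<Longrightarrow> \<exists>v\<in>words X. word_cong X R (v @ u) []"
proof (induction u)
  case Nil
  then show ?case by (auto intro!: bexI[of _ "[]"] word_cong.refl)
next
  case (Cons l u)
  obtain x b where l: "l = (x, b)" by (cases l)
  with Cons obtain v where v: "v \<in> words X" "word_cong X R (v @ u) []" and x: "x \<in> X"
    by auto
  have "word_cong X R (v @ [(x, \<not> b), (x, b)] @ u) (v @ [] @ u)"
    using v x Cons.prems
    by (intro word_cong.append word_cong_inverse_letter word_cong.refl) auto
  then have "word_cong X R ((v @ [(x, \<not> b)]) @ l # u) []"
    using v(2) l word_cong.trans by fastforce
  then show ?case using v(1) x by (intro bexI[of _ "v @ [(x, \<not> b)]"]) auto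
qed

lemma group_presented_group: "group (presented_group X R)"
proof (rule groupI)
  fix A assume "A \<in> carrier (presented_group X R)"
  then obtain u where u: "u \<in> words X" "A = word_class X R u"
    by (auto simp: carrier_presented_group)
  then obtain v where v: "v \<in> words X" "word_cong X R (v @ u) []"
    using word_cong_left_inverse by blast
  have "word_class X R v \<otimes>\<^bsub>presented_group X R\<^esub> A = \<one>\<^bsub>presented_group X R\<^esub>"
    using u v by (simp add: presented_group_mult one_presented_group word_class_eq_iff)
  then show "\<exists>B\<in>carrier (presented_group X R). B \<otimes>\<^bsub>presented_group X R\<^esub> A = \<one>\<^bsub>presented_group X R\<^esub>"
    using v(1) by (auto simp: carrier_presented_group)
qed (auto simp: carrier_presented_group one_presented_group presented_group_mult)

lemma presented_group_generated:
  "carrier (presented_group X R) =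
     generate (presented_group X R) ((\<lambda>x. word_class X R [(x, True)]) ` X)" (is "_ = generate ?P ?S")
proof
  interpret P: group ?P by (rule group_presented_group)
  have S: "?S \<subseteq> carrier ?P" by (auto simp: carrier_presented_group)
  then show "generate ?P ?S \<subseteq> carrier ?P" by (rule P.generate_incl)
  have letter: "word_class X R [(x, b)] \<in> generate ?P ?S" if x: "x \<in> X" for x b
  proof (cases b)
    case True
    then show ?thesis using x by (auto intro: generate.incl)
  next
    case False
    have "word_class X R [(x, False)] \<otimes>\<^bsub>?P\<^esub> word_class X R [(x, True)] = \<one>\<^bsub>?P\<^esub>"
      using x word_cong.cancel[of x X R False]
      by (simp add: presented_group_mult one_presented_group word_class_eq_iff)
    then have "word_class X R [(x, False)] = inv\<^bsub>?P\<^esub> word_class X R [(x, True)]"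
      using x by (intro P.inv_equality[symmetric]) (auto simp: carrier_presented_group)
    then show ?thesis using False x by (auto intro: generate.inv)
  qed
  have "word_class X R u \<in> generate ?P ?S" if "u \<in> words X" for u
    using that
  proof (induction u)
    case Nil
    then show ?case using generate.one[of ?P ?S] by (simp add: one_presented_group)
  next
    case (Cons l u)
    have "word_class X R (l # u) = word_class X R [l] \<otimes>\<^bsub>?P\<^esub> word_class X R u"
      using Cons.prems by (simp add: presented_group_mult)
    then show ?case using Cons letter[of "fst l" "snd l"] by (auto intro: generate.eng)
  qed
  then show "carrier ?P \<subseteq> generate ?P ?S" by (auto simp: carrier_presented_group)
qed

lemma (in group) word_eval_closed:
  "\<phi> \<in> X \<rightarrow> carrier G \<Longrightarrow> u \<in> words X \<Longrightarrow> word_eval G \<phi> u \<in> carrier G"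
  by (induction u) (auto simp: Pi_iff)

lemma (in group) word_eval_append:
  "\<phi> \<in> X \<rightarrow> carrier G \<Longrightarrow> u \<in> words X \<Longrightarrow> v \<in> words X \<Longrightarrow>
    word_eval G \<phi> (u @ v) = word_eval G \<phi> u \<otimes> word_eval G \<phi> v"
  by (induction u) (auto simp: Pi_iff word_eval_closed m_assoc)

lemma (in group) word_eval_cong:
  assumes \<phi>: "\<phi> \<in> X \<rightarrow> carrier G"
    and R: "\<And>u v. (u, v) \<in> R \<Longrightarrow> u \<in> words X \<Longrightarrow> v \<in> words X \<Longrightarrow> word_eval G \<phi> u = word_eval G \<phi> v"
    and "word_cong X R u v"
  shows "word_eval G \<phi> u = word_eval G \<phi> v"
  using assms(3)
proof (induction rule: word_cong.induct)
  case (append u v u' v')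
  then show ?case using word_cong_words by (metis word_eval_append[OF \<phi>])
qed (use \<phi> R in \<open>auto simp: Pi_iff\<close>)

text \<open>
  The universal property of a presentation: evaluation of words is constant on the classes because
  it respects each rule that generates \<^const>\<open>word_cong\<close>.
\<close>

lemma (in group) presented_map_word_class:
  assumes \<phi>: "\<phi> \<in> X \<rightarrow> carrier G"
    and R: "\<And>u v. (u, v) \<in> R \<Longrightarrow> u \<in> words X \<Longrightarrow> v \<in> words X \<Longrightarrow> word_eval G \<phi> u = word_eval G \<phi> v"
    and u: "u \<in> words X"
  shows "presented_map G \<phi> (word_class X R u) = word_eval G \<phi> u"
proof -
  have "word_eval G \<phi> ` word_class X R u = (\<lambda>v. word_eval G \<phi> u) ` word_class X R u"
    by (intro image_cong refl)
       (use word_eval_cong[OF assms(1,2), of R u] in \<open>auto simp: word_class_def\<close>)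
  also have "\<dots> = {word_eval G \<phi> u}"
    by (rule image_constant[of u]) (simp add: word_class_def word_cong.refl u)
  finally have "word_eval G \<phi> ` word_class X R u = {word_eval G \<phi> u}" .
  then show ?thesis by (simp add: presented_map_def)
qed

lemma (in group) presented_map_hom:
  assumes \<phi>: "\<phi> \<in> X \<rightarrow> carrier G"
    and R: "\<And>u v. (u, v) \<in> R \<Longrightarrow> u \<in> words X \<Longrightarrow> v \<in> words X \<Longrightarrow> word_eval G \<phi> u = word_eval G \<phi> v"
  shows "group_hom (presented_group X R) G (presented_map G \<phi>)"
proof -
  note eq = presented_map_word_class[OF assms]
  have "presented_map G \<phi> \<in> hom (presented_group X R) G"
    using word_eval_closed[OF \<phi>] word_eval_append[OF \<phi>]
    by (auto simp: hom_def carrier_presented_group presented_group_mult eq)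
  then show ?thesis by (simp add: group_homI group_presented_group)
qed

section \<open>Crossed and exterior pairings\<close>

text \<open>
  A crossed pairing obeys the relations that define \<open>G \<otimes> G\<close>, so such pairings into \<open>H\<close> are the same as
  homomorphisms \<open>G \<otimes> G \<rightarrow> H\<close>; exterior pairings play the same role for \<open>G \<and> G\<close>. The symbols
  \<open>g \<otimes> h\<close>, the symbols \<open>g \<and> h\<close>, commutators and commutators of lifts to a central extension are all
  instances, and are treated together.
\<close>

locale crossed_pairing = G: group G + H: group H
  for G :: "('a, 'm) monoid_scheme" (structure) and H :: "('b, 'k) monoid_scheme" (structure)
    and e :: "'a \<Rightarrow> 'a \<Rightarrow> 'b" +
  assumes closed [simp]: "g \<in> carrier G \<Longrightarrow> h \<in> carrier G \<Longrightarrow> e g h \<in> carrier H"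
    and mult_left: "g \<in> carrier G \<Longrightarrow> g' \<in> carrier G \<Longrightarrow> h \<in> carrier G \<Longrightarrow>
      e (g \<otimes> g') h = e (conjugate G g g') (conjugate G g h) \<otimes>\<^bsub>H\<^esub> e g h"
    and mult_right: "g \<in> carrier G \<Longrightarrow> h \<in> carrier G \<Longrightarrow> h' \<in> carrier G \<Longrightarrow>
      e g (h \<otimes> h') = e g h \<otimes>\<^bsub>H\<^esub> e (conjugate G h g) (conjugate G h h')"

text \<open>
  Expand \<open>e (g a) (h b)\<close> in the two possible orders, first the left or first the right argument. The
  two results begin with the same factor and end with the same factor; comparison of the middle
  parts gives the identity.
\<close>

lemma (in crossed_pairing) braid:
  assumes "g \<in> carrier G" "h \<in> carrier G" "a \<in> carrier G" "b \<in> carrier G"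
  shows "e (conjugate G (g \<otimes> h) a) (conjugate G (g \<otimes> h) b) \<otimes>\<^bsub>H\<^esub> e g h =
    e g h \<otimes>\<^bsub>H\<^esub> e (conjugate G (h \<otimes> g) a) (conjugate G (h \<otimes> g) b)"
proof -
  let ?A = "e (conjugate G g a) (conjugate G g h)"
  let ?B = "e (conjugate G (g \<otimes> h) a) (conjugate G (g \<otimes> h) b)"
  let ?E = "e (conjugate G (h \<otimes> g) a) (conjugate G (h \<otimes> g) b)"
  let ?D = "e (conjugate G h g) (conjugate G h b)"
  have "e (g \<otimes> a) (h \<otimes> b) = ?A \<otimes>\<^bsub>H\<^esub> (?B \<otimes>\<^bsub>H\<^esub> e g h) \<otimes>\<^bsub>H\<^esub> ?D"
    using assms by (subst mult_left)
      (simp_all add: mult_right G.conjugate_mult G.conjugate_conjugate_conjugate H.m_assoc)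
  moreover have "e (g \<otimes> a) (h \<otimes> b) = ?A \<otimes>\<^bsub>H\<^esub> (e g h \<otimes>\<^bsub>H\<^esub> ?E) \<otimes>\<^bsub>H\<^esub> ?D"
    using assms by (subst mult_right)
      (simp_all add: mult_left G.conjugate_mult G.conjugate_conjugate_conjugate H.m_assoc)
  ultimately show ?thesis using assms by simp
qed

text \<open>
  Conjugation by \<open>e g h\<close> acts on the values of \<open>e\<close> in the way \<open>[g, h]\<close> acts on the arguments. This is the
  source of the centrality of \<open>H\<^sub>2\<close>: an element with trivial commutator must act trivially.
\<close>

lemma (in crossed_pairing) conjugate_pairing:
  assumes "g \<in> carrier G" "h \<in> carrier G" "a \<in> carrier G" "b \<in> carrier G"
  shows "conjugate H (e g h) (e a b) =
    e (conjugate G (commutator G g h) a) (conjugate G (commutator G g h) b)"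
proof -
  \<comment> \<open>Undoing the conjugation by \<open>h g\<close> on the right of the braid identity leaves \<open>g h (h g)\<^sup>-\<^sup>1 = [g, h]\<close> on the left.\<close>
  define c where "c = conjugate G (inv (h \<otimes> g))"
  have hg: "conjugate G (h \<otimes> g) (c x) = x"
    and gh: "conjugate G (g \<otimes> h) (c x) = conjugate G (commutator G g h) x"
    and c: "c x \<in> carrier G" if "x \<in> carrier G" for x
    using assms(1,2) that
    by (simp_all add: c_def conjugate_def commutator_def G.group_normalize)
  have "e g h \<otimes>\<^bsub>H\<^esub> e a b =
      e (conjugate G (commutator G g h) a) (conjugate G (commutator G g h) b) \<otimes>\<^bsub>H\<^esub> e g h"
    using braid[of g h "c a" "c b"] assms c by (simp add: hg gh)
  then show ?thesis
    using assms by (simp add: conjugate_def H.m_assoc)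
qed

text \<open>
  Both sides are actions of \<open>z\<close>, the right one through the homomorphism \<open>k\<close> that extends
  \<open>e g h \<mapsto> [g, h]\<close>, so the case of a single value \<open>e g h\<close> extends to all products of such
  values and their inverses.
\<close>

lemma (in crossed_pairing) conjugate_pairing_by_generated:
  assumes comm: "group_hom H G k" "\<And>g h. g \<in> carrier G \<Longrightarrow> h \<in> carrier G \<Longrightarrow> k (e g h) = commutator G g h"
    and z: "z \<in> generate H ((\<lambda>(g, h). e g h) ` (carrier G \<times> carrier G))"
    and ab: "a \<in> carrier G" "b \<in> carrier G"
  shows "conjugate H z (e a b) = e (conjugate G (k z) a) (conjugate G (k z) b)"
proof -
  interpret k: group_hom H G k by fact
  let ?S = "(\<lambda>(g, h). e g h) ` (carrier G \<times> carrier G)"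
  have S: "?S \<subseteq> carrier H" by auto
  from z ab show ?thesis
  proof (induction z arbitrary: a b rule: generate.induct)
    case one
    then show ?case by (simp add: G.conjugate_one H.conjugate_one)
  next
    case (incl z)
    then show ?case using conjugate_pairing comm(2) by auto
  next
    case (inv z)
    then obtain g h where gh: "g \<in> carrier G" "h \<in> carrier G" "z = e g h" by auto
    define c where "c = commutator G g h"
    have c: "c \<in> carrier G" using gh by (simp add: c_def)
    have "conjugate H z (e (conjugate G (inv c) a) (conjugate G (inv c) b)) = e a b"
      using gh inv(2,3) by (simp add: conjugate_pairing G.conjugate_conjugate G.conjugate_one c_def)
    then have "conjugate H (inv\<^bsub>H\<^esub> z) (e a b) = e (conjugate G (inv c) a) (conjugate G (inv c) b)"
      using gh inv(2,3) c by (metis G.conjugate_closed G.inv_closed H.conjugate_conjugate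
          H.conjugate_one H.inv_closed H.l_inv closed)
    then show ?case using gh by (simp add: comm(2) c_def)
  next
    case (eng y z)
    then have yz: "y \<in> carrier H" "z \<in> carrier H" using H.generate_in_carrier[OF S] by auto
    then have "conjugate H (y \<otimes>\<^bsub>H\<^esub> z) (e a b) = conjugate H y (conjugate H z (e a b))"
      using eng.prems by (simp add: H.conjugate_conjugate)
    then show ?case using eng yz by (simp add: G.conjugate_conjugate)
  qed
qed

lemma (in group) center_if_fixes_generators:
  assumes gen: "carrier G = generate G S" and S: "S \<subseteq> carrier G" and z: "z \<in> carrier G"
    and fixed: "\<And>s. s \<in> S \<Longrightarrow> conjugate G z s = s"
  shows "z \<in> center G"
proof -
  have hom: "group_hom G G (conjugate G z)"
    using z by (intro group_homI is_group homI) (auto simp: conjugate_mult)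
  have id: "group_hom G G (\<lambda>x. x)"
    by (intro group_homI is_group homI) auto
  have "z \<otimes> x = x \<otimes> z" if x: "x \<in> carrier G" for x
  proof -
    have "conjugate G z x = x"
      using group_hom.hom_eq_on_generate[OF hom id S fixed] x gen by simp
    then show ?thesis using z x by (metis conjugate_def inv_closed inv_solve_right' m_closed)
  qed
  then show ?thesis using z by (simp add: center_def)
qed

locale exterior_pairing = crossed_pairing +
  assumes diagonal: "g \<in> carrier G \<Longrightarrow> e g g = \<one>\<^bsub>H\<^esub>"

lemma (in group) exterior_pairing_commutator: "exterior_pairing G G (commutator G)"
  by unfold_locales (simp_all add: commutator_def conjugate_def group_normalize)

lemma (in exterior_pairing) pullback:
  assumes "group_hom K G f"
  shows "exterior_pairing K H (\<lambda>x y. e (f x) (f y))"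
proof -
  interpret f: group_hom K G f by fact
  show ?thesis
    by unfold_locales (simp_all add: mult_left mult_right diagonal f.hom_conjugate)
qed

section \<open>The exterior square\<close>

lemma group_tensor_square: "group (tensor_square G)"
  unfolding tensor_square_def by (rule group_presented_group)

lemma (in group) tensor_crossed_pairing: "crossed_pairing G (tensor_square G) (tensor G)"
proof -
  let ?X = "carrier G \<times> carrier G" and ?R = "tensor_relations G"
  have eq: "word_class ?X ?R u = word_class ?X ?R v"
    if "(u, v) \<in> ?R" "u \<in> words ?X" "v \<in> words ?X" for u v
    using that by (simp add: word_class_eq_iff word_cong.rel)
  interpret T: group "tensor_square G" by (rule group_tensor_square)
  show ?thesis
  proof unfold_locales
    fix g h h' assume [simp]: "g \<in> carrier G" "h \<in> carrier G" "h' \<in> carrier G"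
    show "tensor G g h \<in> carrier (tensor_square G)"
      by (auto simp: tensor_def tensor_square_def carrier_presented_group)
    have "([((g, h \<otimes> h'), True)], [((g, h), True), ((conjugate G h g, conjugate G h h'), True)]) \<in> ?R"
      unfolding tensor_relations_def by fastforce
    from eq[OF this] show "tensor G g (h \<otimes> h') = tensor G g h \<otimes>\<^bsub>tensor_square G\<^esub>
        tensor G (conjugate G h g) (conjugate G h h')"
      unfolding tensor_def tensor_square_def
      by (simp add: presented_group_mult)
  next
    fix g g' h assume [simp]: "g \<in> carrier G" "g' \<in> carrier G" "h \<in> carrier G"
    have "([((g \<otimes> g', h), True)], [((conjugate G g g', conjugate G g h), True), ((g, h), True)]) \<in> ?R"
      unfolding tensor_relations_def by fastforce
    from eq[OF this] show "tensor G (g \<otimes> g') h = tensor G (conjugate G g g') (conjugate G g h)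
        \<otimes>\<^bsub>tensor_square G\<^esub> tensor G g h"
      unfolding tensor_def tensor_square_def
      by (simp add: presented_group_mult)
  qed
qed

lemma tensor_square_generated:
  "carrier (tensor_square G) =
     generate (tensor_square G) ((\<lambda>(g, h). tensor G g h) ` (carrier G \<times> carrier G))"
proof -
  have "(\<lambda>(g, h). tensor G g h) = (\<lambda>x. word_class (carrier G \<times> carrier G) (tensor_relations G) [(x, True)])"
    by (auto simp: tensor_def)
  then show ?thesis unfolding tensor_square_def by (simp only: presented_group_generated)
qed

text \<open>
  The relations of the presentation are exactly the two laws of a crossed pairing.
\<close>

lemma (in crossed_pairing) tensor_universal:
  shows "group_hom (tensor_square G) H (presented_map H (\<lambda>(g, h). e g h))"
    and "g \<in> carrier G \<Longrightarrow> h \<in> carrier G \<Longrightarrow> presented_map H (\<lambda>(g, h). e g h) (tensor G g h) = e g h"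
proof -
  let ?X = "carrier G \<times> carrier G"
  have \<phi>: "(\<lambda>(g, h). e g h) \<in> ?X \<rightarrow> carrier H" by auto
  have R: "word_eval H (\<lambda>(g, h). e g h) u = word_eval H (\<lambda>(g, h). e g h) v"
    if "(u, v) \<in> tensor_relations G" for u v
    using that by (auto simp: tensor_relations_def mult_left mult_right)
  show "group_hom (tensor_square G) H (presented_map H (\<lambda>(g, h). e g h))"
    unfolding tensor_square_def by (rule H.presented_map_hom[OF \<phi> R])
  show "presented_map H (\<lambda>(g, h). e g h) (tensor G g h) = e g h"
    if "g \<in> carrier G" "h \<in> carrier G" for g h
    unfolding tensor_def
    by (subst H.presented_map_word_class[OF \<phi> R]) (use that in auto)
qed

lemma (in group) tensor_diagonal_normal: "tensor_diagonal G \<lhd> tensor_square G"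
proof -
  interpret crossed_pairing G "tensor_square G" "tensor G" by (rule tensor_crossed_pairing)
  show ?thesis unfolding tensor_diagonal_def by (rule H.normal_closure_normal) auto
qed

lemma (in group) group_exterior_square: "group (exterior_square G)"
  unfolding exterior_square_def by (rule normal.factorgroup_is_group[OF tensor_diagonal_normal])

lemma (in group) exterior_square_projection:
  "group_hom (tensor_square G) (exterior_square G) (\<lambda>t. tensor_diagonal G #>\<^bsub>tensor_square G\<^esub> t)"
  unfolding exterior_square_def by (rule normal_quotient_hom[OF tensor_diagonal_normal])

lemma (in group) wedge_exterior_pairing: "exterior_pairing G (exterior_square G) (wedge G)"
proof -
  interpret T: crossed_pairing G "tensor_square G" "tensor G" by (rule tensor_crossed_pairing)
  interpret q: group_hom "tensor_square G" "exterior_square G"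
      "\<lambda>t. tensor_diagonal G #>\<^bsub>tensor_square G\<^esub> t"
    by (rule exterior_square_projection)
  show ?thesis
  proof unfold_locales
    fix g assume g: "g \<in> carrier G"
    have "tensor G g g \<in> tensor_diagonal G"
      unfolding tensor_diagonal_def by (rule subsetD[OF normal_closure_incl imageI[OF g]])
    then have "wedge G g g = tensor_diagonal G"
      unfolding wedge_def
      using T.H.rcoset_eq_self_iff[OF normal_imp_subgroup[OF tensor_diagonal_normal]] g by simp
    then show "wedge G g g = \<one>\<^bsub>exterior_square G\<^esub>" by (simp add: exterior_square_def)
  qed (simp_all add: wedge_def T.mult_left T.mult_right)
qed

lemma (in group) exterior_square_generated:
  "carrier (exterior_square G) =
     generate (exterior_square G) ((\<lambda>(g, h). wedge G g h) ` (carrier G \<times> carrier G))"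
proof -
  interpret T: crossed_pairing G "tensor_square G" "tensor G" by (rule tensor_crossed_pairing)
  interpret q: group_hom "tensor_square G" "exterior_square G"
      "\<lambda>t. tensor_diagonal G #>\<^bsub>tensor_square G\<^esub> t"
    by (rule exterior_square_projection)
  let ?q = "\<lambda>t. tensor_diagonal G #>\<^bsub>tensor_square G\<^esub> t"
  let ?S = "(\<lambda>(g, h). tensor G g h) ` (carrier G \<times> carrier G)"
  have "carrier (exterior_square G) = ?q ` generate (tensor_square G) ?S"
    by (simp add: exterior_square_def carrier_FactGroup flip: tensor_square_generated)
  also have "\<dots> = generate (exterior_square G) (?q ` ?S)"
    by (rule q.generate_img[symmetric]) auto
  also have "?q ` ?S = (\<lambda>(g, h). wedge G g h) ` (carrier G \<times> carrier G)"
    unfolding image_image by (intro image_cong) (auto simp: wedge_def)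
  finally show ?thesis .
qed

text \<open>
  The homomorphism that a crossed pairing induces on the tensor square has a normal kernel, so it
  kills the whole normal closure of the diagonal as soon as it kills the diagonal itself.
\<close>

lemma (in exterior_pairing) exterior_universal:
  shows "group_hom (exterior_square G) H (coset_map (presented_map H (\<lambda>(g, h). e g h)))"
    and "g \<in> carrier G \<Longrightarrow> h \<in> carrier G \<Longrightarrow>
      coset_map (presented_map H (\<lambda>(g, h). e g h)) (wedge G g h) = e g h"
proof -
  interpret T: crossed_pairing G "tensor_square G" "tensor G" by (rule G.tensor_crossed_pairing)
  note hom = tensor_universal(1)
  have "(\<lambda>g. tensor G g g) ` carrier G \<subseteq> kernel (tensor_square G) H (presented_map H (\<lambda>(g, h). e g h))"
    by (auto simp: kernel_def tensor_universal(2) diagonal)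
  then have ker: "tensor_diagonal G \<subseteq> kernel (tensor_square G) H (presented_map H (\<lambda>(g, h). e g h))"
    unfolding tensor_diagonal_def by (intro normal_closure_minimal group_hom.normal_kernel[OF hom])
  show "group_hom (exterior_square G) H (coset_map (presented_map H (\<lambda>(g, h). e g h)))"
    unfolding exterior_square_def by (rule coset_map_hom[OF G.tensor_diagonal_normal hom ker])
  show "coset_map (presented_map H (\<lambda>(g, h). e g h)) (wedge G g h) = e g h"
    if "g \<in> carrier G" "h \<in> carrier G" for g h
    unfolding wedge_def using that
    by (simp add: coset_map_rcoset[OF G.tensor_diagonal_normal hom ker] tensor_universal(2))
qed

lemma (in group) wedge_commutator_hom:
  shows "group_hom (exterior_square G) G (wedge_commutator G)"
    and "g \<in> carrier G \<Longrightarrow> h \<in> carrier G \<Longrightarrow> wedge_commutator G (wedge G g h) = commutator G g h"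
  unfolding wedge_commutator_def
  by (rule exterior_pairing.exterior_universal[OF exterior_pairing_commutator], assumption?)+

lemma (in group) wedge_commutator_image:
  "wedge_commutator G ` carrier (exterior_square G) = derived G (carrier G)"
proof -
  interpret e: exterior_pairing G "exterior_square G" "wedge G" by (rule wedge_exterior_pairing)
  interpret l: group_hom "exterior_square G" G "wedge_commutator G" by (rule wedge_commutator_hom)
  let ?S = "(\<lambda>(g, h). wedge G g h) ` (carrier G \<times> carrier G)"
  have "wedge_commutator G ` generate (exterior_square G) ?S = generate G (wedge_commutator G ` ?S)"
    by (rule l.generate_img[symmetric]) auto
  also have "wedge_commutator G ` ?S = (\<lambda>(x, y). commutator G x y) ` (carrier G \<times> carrier G)"
    unfolding image_image by (intro image_cong) (auto simp: wedge_commutator_hom(2))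
  finally show ?thesis
    by (simp add: derived_eq_generate flip: exterior_square_generated)
qed

text \<open>
  An element with trivial commutator fixes every \<open>a \<and> b\<close> under conjugation, and these generate
  \<open>G \<and> G\<close>.
\<close>

lemma (in group) H2_central: "H2 G \<subseteq> center (exterior_square G)"
proof
  fix z assume "z \<in> H2 G"
  then have z: "z \<in> carrier (exterior_square G)" "wedge_commutator G z = \<one>"
    by (auto simp: H2_def kernel_def)
  interpret e: exterior_pairing G "exterior_square G" "wedge G" by (rule wedge_exterior_pairing)
  show "z \<in> center (exterior_square G)"
  proof (rule e.H.center_if_fixes_generators[OF exterior_square_generated _ z(1)])
    fix s assume "s \<in> (\<lambda>(g, h). wedge G g h) ` (carrier G \<times> carrier G)"
    then obtain a b where ab: "a \<in> carrier G" "b \<in> carrier G" "s = wedge G a b" by auto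
    then show "conjugate (exterior_square G) z s = s"
      using e.conjugate_pairing_by_generated[OF wedge_commutator_hom
          z(1)[unfolded exterior_square_generated] ab(1,2)] z(2)
      by (simp add: conjugate_one)
  qed auto
qed

section \<open>The relative exterior square\<close>

lemma (in group) exterior_square_hom_eq:
  assumes "group_hom (exterior_square G) K h" and "group_hom (exterior_square G) K k"
    and "\<And>x y. x \<in> carrier G \<Longrightarrow> y \<in> carrier G \<Longrightarrow> h (wedge G x y) = k (wedge G x y)"
    and "w \<in> carrier (exterior_square G)"
  shows "h w = k w"
proof (rule group_hom.hom_eq_on_generate[OF assms(1,2)])
  interpret exterior_pairing G "exterior_square G" "wedge G" by (rule wedge_exterior_pairing)
  show "(\<lambda>(x, y). wedge G x y) ` (carrier G \<times> carrier G) \<subseteq> carrier (exterior_square G)" by auto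
  show "w \<in> generate (exterior_square G) ((\<lambda>(x, y). wedge G x y) ` (carrier G \<times> carrier G))"
    using assms(4) by (simp flip: exterior_square_generated)
qed (use assms(3) in auto)

lemma group_hom_compose:
  "group_hom A B h \<Longrightarrow> group_hom B C k \<Longrightarrow> group_hom A C (\<lambda>x. k (h x))"
  using hom_compose[of h A B k C] by (simp add: group_hom_def group_hom_axioms_def comp_def)

lemma (in group_hom) wedge_map_hom:
  shows "group_hom (exterior_square G) (exterior_square H) (wedge_map H h)"
    and "x \<in> carrier G \<Longrightarrow> y \<in> carrier G \<Longrightarrow> wedge_map H h (wedge G x y) = wedge H (h x) (h y)"
  unfolding wedge_map_def
  by (rule exterior_pairing.exterior_universal
      [OF exterior_pairing.pullback[OF H.wedge_exterior_pairing group_hom_axioms]], assumption?)+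

lemma (in group_hom) wedge_commutator_wedge_map:
  assumes "w \<in> carrier (exterior_square G)"
  shows "wedge_commutator H (wedge_map H h w) = h (wedge_commutator G w)"
proof (rule G.exterior_square_hom_eq[OF _ _ _ assms])
  show "group_hom (exterior_square G) H (\<lambda>w. wedge_commutator H (wedge_map H h w))"
    by (rule group_hom_compose[OF wedge_map_hom(1) H.wedge_commutator_hom(1)])
  show "group_hom (exterior_square G) H (\<lambda>w. h (wedge_commutator G w))"
    by (rule group_hom_compose[OF G.wedge_commutator_hom(1) group_hom_axioms])
qed (simp add: wedge_map_hom(2) G.wedge_commutator_hom(2) H.wedge_commutator_hom(2) hom_commutator)

lemma (in group_hom) H2_image_subset: "H2_image G H h \<subseteq> H2 H"
  using group_hom.hom_closed[OF wedge_map_hom(1)]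
  by (auto simp: H2_image_def H2_def kernel_def wedge_commutator_wedge_map)

lemma (in group) H2_subgroup: "subgroup (H2 G) (exterior_square G)"
  unfolding H2_def by (rule group_hom.subgroup_kernel[OF wedge_commutator_hom(1)])

lemma (in group_hom) H2_image_subgroup: "subgroup (H2_image G H h) (exterior_square H)"
  unfolding H2_image_def
  by (rule group_hom.subgroup_img_is_subgroup[OF wedge_map_hom(1) G.H2_subgroup])

text \<open>
  Normal because central, being contained in \<open>H\<^sub>2\<close> of the target; this is what makes the relative
  exterior square a group.
\<close>

lemma (in group_hom) H2_image_normal: "H2_image G H h \<lhd> exterior_square H"
  using H2_image_subset H.H2_central
  by (intro group.central_subgroup_normal[OF H.group_exterior_square H2_image_subgroup]) blast

lemma (in group_hom) group_relative_exterior_square: "group (relative_exterior_square G H h)"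
  unfolding relative_exterior_square_def by (rule normal.factorgroup_is_group[OF H2_image_normal])

lemma (in group_hom) relative_projection:
  "group_hom (exterior_square H) (relative_exterior_square G H h)
     (\<lambda>w. H2_image G H h #>\<^bsub>exterior_square H\<^esub> w)"
  unfolding relative_exterior_square_def by (rule normal_quotient_hom[OF H2_image_normal])

lemma (in group_hom) carrier_relative_exterior_square:
  "carrier (relative_exterior_square G H h) =
     (\<lambda>w. H2_image G H h #>\<^bsub>exterior_square H\<^esub> w) ` carrier (exterior_square H)"
  by (simp add: relative_exterior_square_def carrier_FactGroup)

text \<open>
  A homomorphism on the exterior square descends to the relative one as soon as it is trivial on the
  classes that come from \<open>H\<^sub>2\<close> of the source.
\<close>

lemma (in group_hom) relative_universal:
  assumes "group_hom (exterior_square H) K k"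
    and "\<And>w. w \<in> H2 G \<Longrightarrow> k (wedge_map H h w) = \<one>\<^bsub>K\<^esub>"
  shows "group_hom (relative_exterior_square G H h) K (coset_map k)"
    and "w \<in> carrier (exterior_square H) \<Longrightarrow>
      coset_map k (H2_image G H h #>\<^bsub>exterior_square H\<^esub> w) = k w"
proof -
  have ker: "H2_image G H h \<subseteq> kernel (exterior_square H) K k"
    using assms(2) subgroup.subset[OF H2_image_subgroup] by (auto simp: kernel_def H2_image_def)
  show "group_hom (relative_exterior_square G H h) K (coset_map k)"
    unfolding relative_exterior_square_def
    by (rule coset_map_hom[OF H2_image_normal assms(1) ker])
  show "w \<in> carrier (exterior_square H) \<Longrightarrow>
      coset_map k (H2_image G H h #>\<^bsub>exterior_square H\<^esub> w) = k w"
    by (rule coset_map_rcoset[OF H2_image_normal assms(1) ker])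
qed

lemma (in group_hom) relative_commutator_hom:
  shows "group_hom (relative_exterior_square G H h) H (relative_commutator H)"
    and "w \<in> carrier (exterior_square H) \<Longrightarrow>
      relative_commutator H (H2_image G H h #>\<^bsub>exterior_square H\<^esub> w) = wedge_commutator H w"
proof -
  have "wedge_commutator H (wedge_map H h w) = \<one>\<^bsub>H\<^esub>" if "w \<in> H2 G" for w
    using that by (simp add: H2_def kernel_def wedge_commutator_wedge_map)
  note universal = relative_universal[OF H.wedge_commutator_hom(1) this]
  show "group_hom (relative_exterior_square G H h) H (relative_commutator H)"
    unfolding relative_commutator_def by (rule universal(1))
  show "w \<in> carrier (exterior_square H) \<Longrightarrow>
      relative_commutator H (H2_image G H h #>\<^bsub>exterior_square H\<^esub> w) = wedge_commutator H w"
    unfolding relative_commutator_def by (rule universal(2))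
qed

lemma (in group_hom) relative_commutator_epi:
  "relative_commutator H \<in> epi (relative_exterior_square G H h) (commutator_group H)"
proof -
  interpret c: group_hom "relative_exterior_square G H h" H "relative_commutator H"
    by (rule relative_commutator_hom)
  have "relative_commutator H ` carrier (relative_exterior_square G H h) =
      wedge_commutator H ` carrier (exterior_square H)"
    unfolding carrier_relative_exterior_square image_image
    by (intro image_cong) (auto simp: relative_commutator_hom(2))
  also have "\<dots> = derived H (carrier H)" by (rule H.wedge_commutator_image)
  finally show ?thesis
    by (auto simp: epi_def hom_def commutator_group_def)
qed

lemma FactGroup_restrict:
  "A\<lparr>carrier := K\<rparr> Mod N = (A Mod N)\<lparr>carrier := (\<lambda>x. N #>\<^bsub>A\<^esub> x) ` K\<rparr>"
  by (auto simp: FactGroup_def RCOSETS_def r_coset_def set_mult_def fun_eq_iff)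

text \<open>
  The elements of both groups are cosets of the same subgroup, so the first term of the upper row
  equals the kernel of the commutator map, and exactness of that row reduces to surjectivity.
\<close>

lemma (in group_hom) H2_quotient_eq_kernel:
  "H2_quotient G H h = (relative_exterior_square G H h)
     \<lparr>carrier := kernel (relative_exterior_square G H h) (commutator_group H) (relative_commutator H)\<rparr>"
proof -
  let ?c = "\<lambda>w. H2_image G H h #>\<^bsub>exterior_square H\<^esub> w"
  have "kernel (relative_exterior_square G H h) (commutator_group H) (relative_commutator H) =
      ?c ` H2 H"
    by (auto simp: kernel_def H2_def carrier_relative_exterior_square relative_commutator_hom(2)
        commutator_group_def)
  then show ?thesis
    by (simp add: H2_quotient_def relative_exterior_square_def FactGroup_restrict)
qed

text \<open>
  Two elements of the exterior square with the same commutator differ by an element of \<open>H\<^sub>2\<close>, whose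
  image dies in the relative exterior square; hence the set in the definition of \<^const>\<open>rho\<close> is a
  singleton.
\<close>

lemma (in group_hom) rho_wedge_commutator:
  assumes w: "w \<in> carrier (exterior_square G)"
  shows "rho G H h (wedge_commutator G w) =
    H2_image G H h #>\<^bsub>exterior_square H\<^esub> wedge_map H h w"
proof -
  let ?c = "\<lambda>w. H2_image G H h #>\<^bsub>exterior_square H\<^esub> wedge_map H h w"
  interpret l: group_hom "exterior_square G" G "wedge_commutator G"
    by (rule G.wedge_commutator_hom)
  interpret r: group_hom "exterior_square G" "relative_exterior_square G H h" ?c
    by (rule group_hom_compose[OF wedge_map_hom(1) relative_projection])
  have c: "?c v = ?c w"
    if v: "v \<in> carrier (exterior_square G)" "wedge_commutator G v = wedge_commutator G w" for v
  proof -
    let ?d = "v \<otimes>\<^bsub>exterior_square G\<^esub> inv\<^bsub>exterior_square G\<^esub> w"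
    have "?d \<in> H2 G" using v w by (simp add: H2_def kernel_def)
    then have "wedge_map H h ?d \<in> H2_image G H h" by (simp add: H2_image_def)
    then have "?c ?d = \<one>\<^bsub>relative_exterior_square G H h\<^esub>"
      using group.rcoset_eq_self_iff[OF H.group_exterior_square H2_image_subgroup]
        subgroup.mem_carrier[OF H2_image_subgroup]
      by (simp add: relative_exterior_square_def)
    then show ?thesis using v(1) w
      by (metis l.G.inv_closed r.H.inv_equality r.H.inv_inv r.hom_closed r.hom_inv r.hom_mult)
  qed
  have "?c ` {v \<in> carrier (exterior_square G). wedge_commutator G v = wedge_commutator G w} =
      (\<lambda>v. ?c w) ` {v \<in> carrier (exterior_square G). wedge_commutator G v = wedge_commutator G w}"
    by (intro image_cong refl) (use c in auto)
  also have "\<dots> = {?c w}" by (rule image_constant[of w]) (simp add: w)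
  finally show ?thesis by (simp add: rho_def)
qed

lemma (in group) derived_wedge_commutatorE:
  assumes "c \<in> carrier (commutator_group G)"
  obtains w where "w \<in> carrier (exterior_square G)" and "wedge_commutator G w = c"
proof -
  have "c \<in> wedge_commutator G ` carrier (exterior_square G)"
    using assms by (simp add: wedge_commutator_image commutator_group_def)
  then show thesis using that by auto
qed

lemma (in group_hom) rho_hom:
  "rho G H h \<in> hom (commutator_group G) (relative_exterior_square G H h)"
proof -
  let ?c = "\<lambda>w. H2_image G H h #>\<^bsub>exterior_square H\<^esub> wedge_map H h w"
  interpret l: group_hom "exterior_square G" G "wedge_commutator G"
    by (rule G.wedge_commutator_hom)
  interpret r: group_hom "exterior_square G" "relative_exterior_square G H h" ?c
    by (rule group_hom_compose[OF wedge_map_hom(1) relative_projection])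
  show ?thesis
  proof (rule homI)
    fix c assume "c \<in> carrier (commutator_group G)"
    then obtain w where "w \<in> carrier (exterior_square G)" "wedge_commutator G w = c"
      by (rule G.derived_wedge_commutatorE)
    then show "rho G H h c \<in> carrier (relative_exterior_square G H h)"
      using rho_wedge_commutator[of w] r.hom_closed[of w] by simp
  next
    fix c d assume "c \<in> carrier (commutator_group G)" "d \<in> carrier (commutator_group G)"
    then obtain v w where vw: "v \<in> carrier (exterior_square G)" "wedge_commutator G v = c"
        "w \<in> carrier (exterior_square G)" "wedge_commutator G w = d"
      by (metis G.derived_wedge_commutatorE)
    then have "c \<otimes>\<^bsub>commutator_group G\<^esub> d = wedge_commutator G (v \<otimes>\<^bsub>exterior_square G\<^esub> w)"
      by (simp add: commutator_group_def)
    then show "rho G H h (c \<otimes>\<^bsub>commutator_group G\<^esub> d) =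
        rho G H h c \<otimes>\<^bsub>relative_exterior_square G H h\<^esub> rho G H h d"
      using vw rho_wedge_commutator r.hom_mult l.G.m_closed by metis
  qed
qed

lemma (in group_hom) relative_commutator_rho:
  assumes "c \<in> carrier (commutator_group G)"
  shows "relative_commutator H (rho G H h c) = h c"
proof -
  obtain w where w: "w \<in> carrier (exterior_square G)" "wedge_commutator G w = c"
    using assms by (rule G.derived_wedge_commutatorE)
  then have "wedge_map H h w \<in> carrier (exterior_square H)"
    using group_hom.hom_closed[OF wedge_map_hom(1)] by blast
  then show ?thesis
    using rho_wedge_commutator[OF w(1)] relative_commutator_hom(2) wedge_commutator_wedge_map w
    by simp
qed

section \<open>Commutators in a central extension\<close>

text \<open>
  The reason why commutators in a central extension depend only on the images of their entries.
\<close>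

lemma (in group) commutator_mult_center:
  assumes "x \<in> carrier G" "y \<in> carrier G" "k \<in> center G"
  shows "commutator G (x \<otimes> k) y = commutator G x y"
    and "commutator G x (y \<otimes> k) = commutator G x y"
proof -
  have k: "k \<in> carrier G" and comm: "\<And>g. g \<in> carrier G \<Longrightarrow> k \<otimes> g = g \<otimes> k"
    using assms(3) by (auto simp: center_def)
  have "commutator G (x \<otimes> k) y = x \<otimes> (k \<otimes> y) \<otimes> inv k \<otimes> inv x \<otimes> inv y"
    using assms(1,2) k by (simp add: commutator_def group_normalize)
  also have "\<dots> = commutator G x y"
    using assms(1,2) k by (simp add: comm commutator_def group_normalize)
  finally show "commutator G (x \<otimes> k) y = commutator G x y" .
  have "commutator G x (y \<otimes> k) = x \<otimes> y \<otimes> (k \<otimes> inv x) \<otimes> inv k \<otimes> inv y"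
    using assms(1,2) k by (simp add: commutator_def group_normalize)
  also have "\<dots> = commutator G x y"
    using assms(1,2) k by (simp add: comm commutator_def group_normalize)
  finally show "commutator G x (y \<otimes> k) = commutator G x y" .
qed

locale central_extension = group_hom E G p
  for E :: "('b, 'k) monoid_scheme" (structure) and G :: "('a, 'm) monoid_scheme" (structure)
    and p :: "'b \<Rightarrow> 'a" +
  assumes surjective: "p ` carrier E = carrier G"
    and central: "kernel E G p \<subseteq> center E"
begin

text \<open>
  The lifts are chosen arbitrarily; the kernel being central, the choice does not matter.
\<close>

definition lifted_commutator :: "'a \<Rightarrow> 'a \<Rightarrow> 'b" where
  "lifted_commutator g h =
     commutator E (inv_into (carrier E) p g) (inv_into (carrier E) p h)"

lemma same_image_imp_central_factor:
  assumes "x \<in> carrier E" "x' \<in> carrier E" "p x = p x'"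
  obtains k where "k \<in> center E" "x' = x \<otimes> k"
proof
  show "inv x \<otimes> x' \<in> center E"
    using assms central by (auto simp: kernel_def)
  show "x' = x \<otimes> (inv x \<otimes> x')"
    using assms by (simp add: G.mult_inv_cancel_left)
qed

lemma lifted_commutator_image:
  assumes "x \<in> carrier E" "y \<in> carrier E"
  shows "lifted_commutator (p x) (p y) = commutator E x y"
proof -
  let ?s = "inv_into (carrier E) p"
  have s: "?s (p x) \<in> carrier E" "p (?s (p x)) = p x" "?s (p y) \<in> carrier E" "p (?s (p y)) = p y"
    using assms by (auto simp: inv_into_into f_inv_into_f)
  obtain k where k: "k \<in> center E" "?s (p x) = x \<otimes> k"
    by (rule same_image_imp_central_factor[of x "?s (p x)"]) (use assms s in auto)
  obtain l where l: "l \<in> center E" "?s (p y) = y \<otimes> l"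
    by (rule same_image_imp_central_factor[of y "?s (p y)"]) (use assms s in auto)
  have "lifted_commutator (p x) (p y) = commutator E (x \<otimes> k) (y \<otimes> l)"
    by (simp add: lifted_commutator_def k l)
  also have "\<dots> = commutator E x y"
    using assms k l s by (metis G.commutator_mult_center)
  finally show ?thesis .
qed

lemma preimageE:
  assumes "g \<in> carrier G" obtains x where "x \<in> carrier E" "g = p x"
  using assms surjective by blast

text \<open>
  Since every element of \<open>G\<close> is an image and lifted commutators can be computed with any lifts, each law
  is a law of the commutators of \<open>E\<close>.
\<close>

lemma lifted_commutator_exterior_pairing: "exterior_pairing G E lifted_commutator"
proof -
  interpret c: exterior_pairing E E "commutator E" by (rule G.exterior_pairing_commutator)
  show ?thesis
  proof unfold_locales
    fix g g' h assume "g \<in> carrier G" "g' \<in> carrier G" "h \<in> carrier G"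
    then obtain x x' y where [simp]: "x \<in> carrier E" "x' \<in> carrier E" "y \<in> carrier E"
        and eq: "g = p x" "g' = p x'" "h = p y"
      by (meson preimageE)
    show "lifted_commutator g h \<in> carrier E"
      by (simp add: eq lifted_commutator_image)
    show "lifted_commutator g g = \<one>"
      by (simp add: eq lifted_commutator_image c.diagonal)
    show "lifted_commutator (g \<otimes>\<^bsub>G\<^esub> g') h =
        lifted_commutator (conjugate G g g') (conjugate G g h) \<otimes> lifted_commutator g h"
      by (simp add: eq lifted_commutator_image c.mult_left flip: hom_mult hom_conjugate)
    show "lifted_commutator h (g \<otimes>\<^bsub>G\<^esub> g') =
        lifted_commutator h g \<otimes> lifted_commutator (conjugate G g h) (conjugate G g g')"
      by (simp add: eq lifted_commutator_image c.mult_right flip: hom_mult hom_conjugate)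
  qed
qed

definition wedge_lift :: "('a \<times> 'a) word set set \<Rightarrow> 'b" where
  "wedge_lift = coset_map (presented_map E (\<lambda>(g, h). lifted_commutator g h))"

lemma wedge_lift_hom: "group_hom (exterior_square G) E wedge_lift"
  unfolding wedge_lift_def
  by (rule exterior_pairing.exterior_universal(1)[OF lifted_commutator_exterior_pairing])

lemma wedge_lift_wedge:
  "x \<in> carrier E \<Longrightarrow> y \<in> carrier E \<Longrightarrow> wedge_lift (wedge G (p x) (p y)) = commutator E x y"
  unfolding wedge_lift_def
  by (simp add: exterior_pairing.exterior_universal(2)[OF lifted_commutator_exterior_pairing]
      lifted_commutator_image)

lemma proj_wedge_lift:
  assumes "w \<in> carrier (exterior_square G)"
  shows "p (wedge_lift w) = wedge_commutator G w"
proof (rule H.exterior_square_hom_eq[OF _ _ _ assms])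
  show "group_hom (exterior_square G) G (\<lambda>w. p (wedge_lift w))"
    by (rule group_hom_compose[OF wedge_lift_hom group_hom_axioms])
  show "group_hom (exterior_square G) G (wedge_commutator G)"
    by (rule H.wedge_commutator_hom)
  fix g h assume gh: "g \<in> carrier G" "h \<in> carrier G"
  then obtain x y where "x \<in> carrier E" "y \<in> carrier E" "g = p x" "h = p y"
    by (meson preimageE)
  then show "p (wedge_lift (wedge G g h)) = wedge_commutator G (wedge G g h)"
    using gh by (simp add: wedge_lift_wedge hom_commutator H.wedge_commutator_hom(2))
qed

text \<open>
  Every commutator of \<open>E\<close> is the lifted commutator of its image in \<open>G\<close>. So although the generators
  \<open>g \<and> h\<close> only know about \<open>G\<close>, they reach all generators of \<open>[E, E]\<close>.
\<close>

lemma wedge_lift_image: "wedge_lift ` carrier (exterior_square G) = derived E (carrier E)"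
proof -
  interpret w: exterior_pairing G "exterior_square G" "wedge G" by (rule H.wedge_exterior_pairing)
  interpret lift: group_hom "exterior_square G" E wedge_lift by (rule wedge_lift_hom)
  let ?W = "(\<lambda>(g, h). wedge G g h) ` (carrier G \<times> carrier G)"
  have "?W = (\<lambda>(x, y). wedge G (p x) (p y)) ` (carrier E \<times> carrier E)"
    by (auto simp: image_iff elim!: preimageE)
  then have "wedge_lift ` ?W = wedge_lift ` (\<lambda>(x, y). wedge G (p x) (p y)) ` (carrier E \<times> carrier E)"
    by (simp only:)
  also have "\<dots> = (\<lambda>(x, y). commutator E x y) ` (carrier E \<times> carrier E)"
    unfolding image_image by (intro image_cong) (auto simp: wedge_lift_wedge)
  finally have "wedge_lift ` ?W = (\<lambda>(x, y). commutator E x y) ` (carrier E \<times> carrier E)" .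
  moreover have "wedge_lift ` generate (exterior_square G) ?W = generate E (wedge_lift ` ?W)"
    by (rule lift.generate_img[symmetric]) auto
  ultimately show ?thesis
    by (simp add: derived_eq_generate flip: H.exterior_square_generated)
qed

text \<open>
  If \<open>f\<close> lifts to \<open>E\<close>, the lift itself supplies lifts of the entries of \<open>f x \<and> f y\<close>. In particular classes
  from \<open>H\<^sub>2(K)\<close>, which have trivial commutator, are sent to the identity.
\<close>

lemma wedge_lift_wedge_map:
  assumes "group_hom K G f" and "group_hom K E ft" and lift: "\<And>x. x \<in> carrier K \<Longrightarrow> p (ft x) = f x"
    and "w \<in> carrier (exterior_square K)"
  shows "wedge_lift (wedge_map G f w) = ft (wedge_commutator K w)"
proof -
  interpret f: group_hom K G f by fact
  interpret ft: group_hom K E ft by fact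
  show ?thesis
  proof (rule f.G.exterior_square_hom_eq[OF _ _ _ assms(4)])
    show "group_hom (exterior_square K) E (\<lambda>w. wedge_lift (wedge_map G f w))"
      by (rule group_hom_compose[OF f.wedge_map_hom(1) wedge_lift_hom])
    show "group_hom (exterior_square K) E (\<lambda>w. ft (wedge_commutator K w))"
      by (rule group_hom_compose[OF f.G.wedge_commutator_hom(1) ft.group_hom_axioms])
    fix x y assume "x \<in> carrier K" "y \<in> carrier K"
    then show "wedge_lift (wedge_map G f (wedge K x y)) = ft (wedge_commutator K (wedge K x y))"
      using wedge_lift_wedge[of "ft x" "ft y"]
      by (simp add: lift f.wedge_map_hom(2) f.G.wedge_commutator_hom(2) ft.hom_commutator)
  qed
qed

end

section \<open>Cardinalities\<close>

text \<open>
  With a section \<open>r\<close> of \<open>h\<close> over its image, every \<open>x\<close> equals \<open>k \<cdot> r (h x)\<close> for some \<open>k\<close> in the kernel.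
\<close>

lemma (in group_hom) carrier_lepoll_kernel_times_image:
  "carrier G \<lesssim> kernel G H h \<times> h ` carrier G"
proof -
  let ?r = "inv_into (carrier G) h"
  have "x \<in> (\<lambda>(k, c). k \<otimes> ?r c) ` (kernel G H h \<times> h ` carrier G)" if x: "x \<in> carrier G" for x
  proof (rule image_eqI)
    have r: "?r (h x) \<in> carrier G" "h (?r (h x)) = h x"
      using x by (auto simp: inv_into_into f_inv_into_f)
    then show "(x \<otimes> inv ?r (h x), h x) \<in> kernel G H h \<times> h ` carrier G"
      using x by (simp add: kernel_def)
    show "x = (case (x \<otimes> inv ?r (h x), h x) of (k, c) \<Rightarrow> k \<otimes> ?r c)"
      using x r by (simp add: G.m_assoc)
  qed
  then show ?thesis by (intro subset_image_lepoll subsetI)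
qed

lemma finite_order_le_if_lepoll_times:
  assumes "carrier A \<lesssim> carrier B \<times> carrier C" and "finite (carrier B)" "finite (carrier C)"
  shows "finite (carrier A) \<and> order A \<le> order B * order C"
proof -
  have fin: "finite (carrier B \<times> carrier C)" using assms(2,3) by simp
  with assms(1) have "finite (carrier A)" using fin by (auto simp: lepoll_def intro: inj_on_finite)
  then show ?thesis
    using lepoll_iff_card_le[of "carrier A" "carrier B \<times> carrier C"] assms(1) fin
    by (simp add: order_def card_cartesian_product)
qed

lemma kernel_short_exact:
  assumes "group B" and "group C" and "q \<in> epi B C"
  shows "short_exact (B\<lparr>carrier := kernel B C q\<rparr>) (\<lambda>x. x) B q C"
proof -
  interpret q: group_hom B C q using assms by (intro group_homI) (auto simp: epi_def)
  have "group (B\<lparr>carrier := kernel B C q\<rparr>)"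
    by (rule q.G.subgroup_imp_group[OF q.subgroup_kernel])
  then show ?thesis
    using assms by (auto simp: short_exact_def mon_def hom_def kernel_def)
qed

section \<open>The morphism of extensions\<close>

theorem corollary4p6:
  fixes \<Gamma> :: "('c, 'n) monoid_scheme" and G :: "('a, 'm) monoid_scheme"
    and Gt :: "('b, 'k) monoid_scheme"
    and f :: "'c \<Rightarrow> 'a" and p :: "'b \<Rightarrow> 'a" and ft :: "'c \<Rightarrow> 'b"
  assumes "group \<Gamma>" and "group G" and "f \<in> hom \<Gamma> G"
    and "central_f_extension \<Gamma> G f Gt p ft"
  shows
    "short_exact (H2_quotient \<Gamma> G f) (\<lambda>x. x) (relative_exterior_square \<Gamma> G f)
        (relative_commutator G) (commutator_group G)
     \<and> short_exact (commutator_kernel Gt G p) (\<lambda>x. x) (commutator_group Gt) p (commutator_group G)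
     \<and> f_extension (commutator_group \<Gamma>) (commutator_group G) f
        (relative_exterior_square \<Gamma> G f) (relative_commutator G) (rho \<Gamma> G f)
     \<and> f_extension (commutator_group \<Gamma>) (commutator_group G) f (commutator_group Gt) p ft
     \<and> (\<exists>S. f_extension_morphism (commutator_group \<Gamma>)
              (relative_exterior_square \<Gamma> G f) (relative_commutator G) (rho \<Gamma> G f)
              (commutator_group Gt) p ft S
          \<and> S \<in> epi (relative_exterior_square \<Gamma> G f) (commutator_group Gt)
          \<and> S \<in> epi (H2_quotient \<Gamma> G f) (commutator_kernel Gt G p))
     \<and> (finite (carrier (H2_quotient \<Gamma> G f)) \<and> finite (carrier (commutator_group G)) \<longrightarrow>
          finite (carrier (commutator_group Gt)) \<and>
          order (commutator_group Gt) \<le> order (H2_quotient \<Gamma> G f) * order (commutator_group G))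
     \<and> carrier (commutator_group Gt) \<lesssim>
          carrier (H2_quotient \<Gamma> G f) \<times> carrier (commutator_group G)"
proof -
  have ext: "group Gt" "p \<in> epi Gt G" "ft \<in> hom \<Gamma> Gt"
      and lift: "\<And>x. x \<in> carrier \<Gamma> \<Longrightarrow> p (ft x) = f x"
      and central: "kernel Gt G p \<subseteq> center Gt"
    using assms(4) by (auto simp: central_f_extension_def f_extension_def)
  interpret f: group_hom \<Gamma> G f by (rule group_homI) fact+
  interpret ft: group_hom \<Gamma> Gt ft by (rule group_homI) fact+
  interpret p: central_extension Gt G p
    using ext assms(2) central
    by (intro central_extension.intro central_extension_axioms.intro group_homI) (simp_all add: epi_def)
  let ?R = "relative_exterior_square \<Gamma> G f"
  let ?\<kappa> = "relative_commutator G"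
  interpret \<kappa>: group_hom ?R G ?\<kappa> by (rule f.relative_commutator_hom)
  have lift_wedge_map: "p.wedge_lift (wedge_map G f w) = ft (wedge_commutator \<Gamma> w)"
    if "w \<in> carrier (exterior_square \<Gamma>)" for w
    using f.group_hom_axioms ft.group_hom_axioms lift that by (rule p.wedge_lift_wedge_map)

  \<comment> \<open>The lift on \<open>G \<and> G\<close> vanishes on \<open>f\<^sub>* H\<^sub>2(\<Gamma>)\<close> because \<open>ft\<close> sends the trivial commutator to the identity.\<close>
  define S where "S = coset_map p.wedge_lift"
  have "p.wedge_lift (wedge_map G f w) = \<one>\<^bsub>Gt\<^esub>" if "w \<in> H2 \<Gamma>" for w
    using that by (simp add: lift_wedge_map H2_def kernel_def)
  note S_universal = f.relative_universal[OF p.wedge_lift_hom this, folded S_def]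
  interpret S: group_hom ?R Gt S by (rule S_universal)
  have S_image: "S ` carrier ?R = derived Gt (carrier Gt)"
    unfolding f.carrier_relative_exterior_square image_image p.wedge_lift_image[symmetric]
    by (intro image_cong) (auto simp: S_universal(2))
  have p_S: "p (S x) = ?\<kappa> x" if "x \<in> carrier ?R" for x
    using that
    by (auto simp: f.carrier_relative_exterior_square S_universal(2) p.proj_wedge_lift f.relative_commutator_hom(2))
  have S_rho: "S (rho \<Gamma> G f c) = ft c" if c: "c \<in> carrier (commutator_group \<Gamma>)" for c
  proof -
    obtain w where w: "w \<in> carrier (exterior_square \<Gamma>)" "wedge_commutator \<Gamma> w = c"
      using c by (rule f.G.derived_wedge_commutatorE)
    then have "wedge_map G f w \<in> carrier (exterior_square G)"
      using group_hom.hom_closed[OF f.wedge_map_hom(1)] by blast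
    then show ?thesis
      using f.rho_wedge_commutator[OF w(1)] w S_universal(2) lift_wedge_map by simp
  qed

  have S_epi: "S \<in> epi ?R (commutator_group Gt)"
    using S_image by (auto simp: epi_def hom_def commutator_group_def)
  have S_epi_kernel: "S \<in> epi (H2_quotient \<Gamma> G f) (commutator_kernel Gt G p)"
  proof -
    have "S ` kernel ?R (commutator_group G) ?\<kappa> = kernel Gt G p \<inter> derived Gt (carrier Gt)"
    proof
      show "S ` kernel ?R (commutator_group G) ?\<kappa> \<subseteq> kernel Gt G p \<inter> derived Gt (carrier Gt)"
        using S_image by (auto simp: kernel_def p_S commutator_group_def)
      show "kernel Gt G p \<inter> derived Gt (carrier Gt) \<subseteq> S ` kernel ?R (commutator_group G) ?\<kappa>"
        unfolding S_image[symmetric] by (auto simp: kernel_def p_S commutator_group_def)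
    qed
    then show ?thesis
      unfolding f.H2_quotient_eq_kernel commutator_kernel_def
      by (auto simp: epi_def hom_def kernel_def)
  qed
  have morphism: "f_extension_morphism (commutator_group \<Gamma>) ?R ?\<kappa> (rho \<Gamma> G f)
      (commutator_group Gt) p ft S"
    using S_epi p_S S_rho by (auto simp: f_extension_morphism_def epi_def)

  have p_epi: "p \<in> epi (commutator_group Gt) (commutator_group G)"
  proof -
    have "p ` derived Gt (carrier Gt) = ?\<kappa> ` carrier ?R"
      unfolding S_image[symmetric] image_image using p_S by (intro image_cong) auto
    also have "\<dots> = carrier (commutator_group G)"
      using f.relative_commutator_epi by (simp add: epi_def)
    finally show ?thesis using p.hom_derived by (simp add: epi_def commutator_group_def)
  qed
  have kernel_eq: "commutator_kernel Gt G p =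
      (commutator_group Gt)\<lparr>carrier := kernel (commutator_group Gt) (commutator_group G) p\<rparr>"
    using ft.H.derived_subset
    by (auto simp: commutator_kernel_def commutator_group_def kernel_def
        intro!: arg_cong[where f = "\<lambda>A. Gt\<lparr>carrier := A\<rparr>"])
  note groups = f.G.group_commutator_group f.H.group_commutator_group ft.H.group_commutator_group
    f.group_relative_exterior_square

  \<comment> \<open>The bound is that of the upper row, transported along the epimorphism \<open>S\<close>.\<close>
  have lepoll: "carrier (commutator_group Gt) \<lesssim>
      carrier (H2_quotient \<Gamma> G f) \<times> carrier (commutator_group G)"
  proof -
    have "carrier (commutator_group Gt) = S ` carrier ?R"
      by (simp add: S_image commutator_group_def)
    also have "\<dots> \<lesssim> carrier ?R" by (rule image_lepoll)
    also have "\<dots> \<lesssim> kernel ?R G ?\<kappa> \<times> ?\<kappa> ` carrier ?R"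
      by (rule \<kappa>.carrier_lepoll_kernel_times_image)
    also have "kernel ?R G ?\<kappa> \<times> ?\<kappa> ` carrier ?R =
        carrier (H2_quotient \<Gamma> G f) \<times> carrier (commutator_group G)"
      using f.relative_commutator_epi
      by (simp add: f.H2_quotient_eq_kernel epi_def kernel_def commutator_group_def)
    finally show ?thesis .
  qed

  show ?thesis
  proof (intro conjI exI[of _ S])
    show "short_exact (H2_quotient \<Gamma> G f) (\<lambda>x. x) ?R ?\<kappa> (commutator_group G)"
      unfolding f.H2_quotient_eq_kernel
      by (intro kernel_short_exact groups f.relative_commutator_epi)
    show "short_exact (commutator_kernel Gt G p) (\<lambda>x. x) (commutator_group Gt) p (commutator_group G)"
      unfolding kernel_eq by (intro kernel_short_exact groups p_epi)
    show "f_extension (commutator_group \<Gamma>) (commutator_group G) f ?R ?\<kappa> (rho \<Gamma> G f)"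
      unfolding f_extension_def
      using groups f.hom_derived f.relative_commutator_epi f.rho_hom f.relative_commutator_rho
      by blast
    show "f_extension (commutator_group \<Gamma>) (commutator_group G) f (commutator_group Gt) p ft"
      unfolding f_extension_def
      using groups f.hom_derived p_epi ft.hom_derived lift f.G.derived_subset
      by (auto simp: commutator_group_def)
    show "finite (carrier (H2_quotient \<Gamma> G f)) \<and> finite (carrier (commutator_group G)) \<longrightarrow>
          finite (carrier (commutator_group Gt)) \<and>
          order (commutator_group Gt) \<le> order (H2_quotient \<Gamma> G f) * order (commutator_group G)"
      using finite_order_le_if_lepoll_times[OF lepoll] by blast
  qed (fact morphism S_epi S_epi_kernel lepoll)+
qed

end
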